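(* Let $S$ and $T$ be numerical semigroups. If the monoid $(\mathfrak{I}_0(S),+)$ is isomorphic to the monoid $(\mathfrak{I}_0(T),+)$, then $S=T$.
   Context: $\mathbb{N}$ denotes the set of non-negative integers. A numerical semigroup $S$ is a submonoid of $(\mathbb{N},+)$ such that $\mathbb{N}\setminus S$ is finite. An ideal of $S$ is a set of integers $I$ having a minimum and such that $I+S\subseteq I$, where $A+B=\{a+b : a\in A, b\in B\}$. The set of normalized ideals of $S$ is $\mathfrak{I}_0(S)=\{I\subseteq\mathbb{N} : I+S\subseteq I,\ \min(I)=0\}$. If $I,J\in\mathfrak{I}_0(S)$ then $I+J\in\mathfrak{I}_0(S)$, and $(\mathfrak{I}_0(S),+)$ is a commutative monoid with identity element $S$. (The ideal class monoid $\mathcal{C}\ell(S)$ is the set of ideals of $S$ modulo the relation $I\sim J$ if $I=z+J$ for some integer $z$, with $[I]+[J]=[I+J]$; it is isomorphic to $(\mathfrak{I}_0(S),+)$ via $[I]\mapsto -\min(I)+I$.) *)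

theory Defs
  imports "HOL-Algebra.Group" "HOL-Library.Set_Algebras"
begin

definition numerical_semigroup :: "nat set \<Rightarrow> bool" where
  "numerical_semigroup S \<longleftrightarrow> 0 \<in> S \<and> (\<forall>a\<in>S. \<forall>b\<in>S. a + b \<in> S) \<and> finite (UNIV - S)"

text \<open>The sum of two sets below is the elementwise sum from \<^theory>\<open>HOL-Library.Set_Algebras\<close>.
  Nonemptiness is required explicitly because \<open>LEAST\<close> is unspecified on the empty set.\<close>

definition normalized_ideals :: "nat set \<Rightarrow> nat set set" where
  "normalized_ideals S = {I. I + S \<subseteq> I \<and> I \<noteq> {} \<and> (LEAST i. i \<in> I) = 0}"

definition normalized_ideal_monoid :: "nat set \<Rightarrow> nat set monoid" where
  "normalized_ideal_monoid S = \<lparr>carrier = normalized_ideals S, mult = (+), one = S\<rparr>"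

lemma mem_normalized_ideals_iff:
  "I \<in> normalized_ideals S \<longleftrightarrow> I + S \<subseteq> I \<and> 0 \<in> I"
proof -
  have "(I \<noteq> {} \<and> (LEAST i. i \<in> I) = 0) \<longleftrightarrow> 0 \<in> I"
    by (metis (mono_tags, lifting) LeastI Least_eq_0 empty_iff ex_in_conv)
  then show ?thesis by (auto simp: normalized_ideals_def)
qed

lemma comm_monoid_normalized_ideal_monoid:
  assumes "numerical_semigroup S"
  shows "comm_monoid (normalized_ideal_monoid S)"
proof -
  have S0: "0 \<in> S" and SS: "S + S \<subseteq> S"
    using assms by (auto simp: numerical_semigroup_def set_plus_def)
  have unit: "S + I = I" if "I \<in> normalized_ideals S" for I
  proof
    show "S + I \<subseteq> I"
      using that by (simp add: mem_normalized_ideals_iff add.commute)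
    show "I \<subseteq> S + I"
      using S0 by (metis add_0 set_plus_intro subsetI)
  qed
  have closed: "I + J \<in> normalized_ideals S"
    if I: "I \<in> normalized_ideals S" and J: "J \<in> normalized_ideals S" for I J
  proof -
    have "(I + J) + S = I + J"
      using unit[OF J] by (simp add: add.assoc add.commute[of J S])
    moreover have "0 + 0 \<in> I + J"
      using I J by (intro set_plus_intro) (auto simp: mem_normalized_ideals_iff)
    ultimately show ?thesis
      by (simp add: mem_normalized_ideals_iff)
  qed
  have "S \<in> normalized_ideals S"
    using S0 SS by (simp add: mem_normalized_ideals_iff)
  moreover have "I + S = I" if "I \<in> normalized_ideals S" for I
    using unit[OF that] by (simp add: add.commute)
  ultimately show ?thesis
    by (intro comm_monoidI)
      (simp_all add: normalized_ideal_monoid_def closed unit ac_simps)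
qed

text \<open>The library's \<^const>\<open>is_iso\<close> does not ask that the identity be preserved; between
  monoids this is automatic.\<close>

lemma iso_preserves_one:
  assumes "monoid G" "monoid H" "h \<in> iso G H"
  shows "h \<one>\<^bsub>G\<^esub> = \<one>\<^bsub>H\<^esub>"
proof -
  interpret G: monoid G by fact
  interpret H: monoid H by fact
  obtain u where u: "u \<in> carrier G" "h u = \<one>\<^bsub>H\<^esub>"
    using assms(3) H.one_closed unfolding iso_iff by (metis imageE)
  have hc: "h \<one>\<^bsub>G\<^esub> \<in> carrier H"
    using assms(3) by (auto simp: iso_iff hom_def)
  have "h (u \<otimes>\<^bsub>G\<^esub> \<one>\<^bsub>G\<^esub>) = h u \<otimes>\<^bsub>H\<^esub> h \<one>\<^bsub>G\<^esub>"
    by (rule hom_mult[OF iso_imp_homomorphism[OF assms(3)] u(1) G.one_closed])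
  with u(1) have "h u = h u \<otimes>\<^bsub>H\<^esub> h \<one>\<^bsub>G\<^esub>"
    by simp
  with u(2) hc show ?thesis
    by (metis H.l_one)
qed

end

theory Submission
  imports Defs
begin

text \<open>The idempotents of the monoid of \<open>S\<close> are the numerical semigroups \<open>R \<supseteq> S\<close>, and the elements
  fixed by adding \<open>R\<close> form the monoid of \<open>R\<close>. By induction on the number of gaps, an isomorphism
  therefore fixes every oversemigroup other than \<open>S\<close>, and so \<open>S\<close> and \<open>T\<close> have the same proper
  oversemigroups. If \<open>S \<noteq> T\<close>, this forces \<open>S \<union> {F} = T \<union> {G}\<close> for the Frobenius numbers \<open>F\<close> and
  \<open>G\<close>, with both semigroups irreducible; say \<open>G < F\<close>. An irreducible semigroup
  contains half of the integers up to its Frobenius number, and comparing the counts gives \<open>F = G + 1\<close>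
  with \<open>F\<close> odd. Then every ideal \<open>I \<noteq> S\<close> contains \<open>F\<close>, that is \<open>I + (S \<union> {F}) = I\<close>, whereas
  \<open>T \<union> {G/2}\<close> is a normalized ideal of \<open>T\<close> without \<open>G\<close>.\<close>

section \<open>Idempotents and oversemigroups\<close>

lemma normalized_ideals_self:
  "numerical_semigroup S \<Longrightarrow> S \<in> normalized_ideals S"
  by (auto simp: mem_normalized_ideals_iff numerical_semigroup_def set_plus_def)

lemma numerical_semigroup_plus_self:
  assumes "numerical_semigroup S"
  shows "S + S = S"
proof
  show "S + S \<subseteq> S"
    using assms by (auto simp: numerical_semigroup_def set_plus_def)
  show "S \<subseteq> S + S"
    using assms by (simp add: numerical_semigroup_def set_zero_plus2)
qed

text \<open>Since \<open>0 \<in> R\<close>, absorbing \<open>S\<close> gives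
  \<open>S \<subseteq> R\<close>, and idempotence then amounts to closure under addition.
  Oversemigroups thus become visible to the monoid structure alone.\<close>

lemma idempotent_normalized_ideal_iff:
  assumes "numerical_semigroup S"
  shows "R \<in> normalized_ideals S \<and> R + R = R \<longleftrightarrow> numerical_semigroup R \<and> S \<subseteq> R"
proof
  assume R: "R \<in> normalized_ideals S \<and> R + R = R"
  have "s \<in> R" if "s \<in> S" for s
    using R that set_plus_intro[of 0 R s S] by (auto simp: mem_normalized_ideals_iff)
  then have "S \<subseteq> R" by blast
  moreover from this have "finite (UNIV - R)"
    using assms by (meson Diff_mono finite_subset numerical_semigroup_def subset_refl)
  moreover have "0 \<in> R" "\<forall>a\<in>R. \<forall>b\<in>R. a + b \<in> R"
    using R set_plus_intro[of _ R _ R] by (auto simp: mem_normalized_ideals_iff)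
  ultimately show "numerical_semigroup R \<and> S \<subseteq> R"
    by (simp add: numerical_semigroup_def)
next
  assume R: "numerical_semigroup R \<and> S \<subseteq> R"
  then have "R + R = R" by (simp add: numerical_semigroup_plus_self)
  moreover from this have "R + S \<subseteq> R"
    using R set_plus_mono2[of R R S R] by simp
  ultimately show "R \<in> normalized_ideals S \<and> R + R = R"
    using R by (simp add: mem_normalized_ideals_iff numerical_semigroup_def)
qed

text \<open>As \<open>I \<subseteq> I + R\<close>, closure of \<open>I\<close> under
  \<open>R\<close> is the equation \<open>I + R = I\<close>, which isomorphisms preserve.\<close>

lemma normalized_ideals_oversemigroup:
  assumes "numerical_semigroup R" "S \<subseteq> R"
  shows "normalized_ideals R = {I \<in> normalized_ideals S. I + R = I}"
proof -
  have "I \<subseteq> I + R" for I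
    using assms set_zero_plus2[of R I] by (simp add: numerical_semigroup_def add.commute)
  moreover have "I + S \<subseteq> I + R" for I
    using assms by (simp add: set_plus_mono2)
  ultimately show ?thesis
    unfolding mem_normalized_ideals_iff set_eq_iff mem_Collect_eq by blast
qed

section \<open>Isomorphisms and their restriction to oversemigroups\<close>

lemma monoid_normalized_ideal_monoid:
  "numerical_semigroup S \<Longrightarrow> monoid (normalized_ideal_monoid S)"
  using comm_monoid_normalized_ideal_monoid by (simp add: comm_monoid_def)

lemma iso_normalized_ideal_monoid_iff:
  "h \<in> iso (normalized_ideal_monoid S) (normalized_ideal_monoid T) \<longleftrightarrow>
    bij_betw h (normalized_ideals S) (normalized_ideals T) \<and>
    (\<forall>I\<in>normalized_ideals S. \<forall>J\<in>normalized_ideals S. h (I + J) = h I + h J)"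
  by (auto simp: iso_def hom_def normalized_ideal_monoid_def bij_betw_def)

lemma normalized_ideals_plus_closed:
  assumes "numerical_semigroup S" "I \<in> normalized_ideals S" "J \<in> normalized_ideals S"
  shows "I + J \<in> normalized_ideals S"
  using monoid.m_closed[OF monoid_normalized_ideal_monoid[OF assms(1)], of I J] assms(2,3)
  by (simp add: normalized_ideal_monoid_def)

lemma iso_normalized_ideal_monoid_inv_into:
  assumes S: "numerical_semigroup S"
    and h: "h \<in> iso (normalized_ideal_monoid S) (normalized_ideal_monoid T)"
  shows "inv_into (normalized_ideals S) h \<in> iso (normalized_ideal_monoid T) (normalized_ideal_monoid S)"
proof -
  let ?g = "inv_into (normalized_ideals S) h"
  have bij: "bij_betw h (normalized_ideals S) (normalized_ideals T)"
    and mult: "\<And>I J. I \<in> normalized_ideals S \<Longrightarrow> J \<in> normalized_ideals S \<Longrightarrow> h (I + J) = h I + h J"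
    using h by (auto simp: iso_normalized_ideal_monoid_iff)
  have "?g (I + J) = ?g I + ?g J" if "I \<in> normalized_ideals T" "J \<in> normalized_ideals T" for I J
  proof -
    have g: "?g I \<in> normalized_ideals S" "?g J \<in> normalized_ideals S"
      using bij that by (metis bij_betw_def inv_into_into)+
    then have "h (?g I + ?g J) = I + J"
      using mult that bij by (simp add: bij_betw_inv_into_right)
    then show ?thesis
      using bij normalized_ideals_plus_closed[OF S g] by (metis bij_betw_inv_into_left)
  qed
  then show ?thesis
    using bij by (simp add: iso_normalized_ideal_monoid_iff bij_betw_inv_into)
qed

text \<open>Both \<open>R + R = R\<close> and \<open>I + R = I\<close> are equations in the monoid,
  so \<open>h\<close> carries them over. The restriction of \<open>h\<close> is the isomorphism to
  which the induction hypothesis is applied later.\<close>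

lemma iso_normalized_ideal_monoid_oversemigroup:
  assumes S: "numerical_semigroup S" and T: "numerical_semigroup T"
    and h: "h \<in> iso (normalized_ideal_monoid S) (normalized_ideal_monoid T)"
    and R: "numerical_semigroup R" "S \<subseteq> R"
  shows "numerical_semigroup (h R)" "T \<subseteq> h R"
    and "h \<in> iso (normalized_ideal_monoid R) (normalized_ideal_monoid (h R))"
proof -
  have bij: "bij_betw h (normalized_ideals S) (normalized_ideals T)"
    and mult: "\<And>I J. I \<in> normalized_ideals S \<Longrightarrow> J \<in> normalized_ideals S \<Longrightarrow> h (I + J) = h I + h J"
    using h by (auto simp: iso_normalized_ideal_monoid_iff)
  have R': "R \<in> normalized_ideals S" "R + R = R"
    using idempotent_normalized_ideal_iff[OF S] R by auto
  then have "h R \<in> normalized_ideals T \<and> h R + h R = h R"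
    using bij mult by (metis bij_betwE)
  then show hR: "numerical_semigroup (h R)" "T \<subseteq> h R"
    using idempotent_normalized_ideal_iff[OF T] by auto
  have sub: "normalized_ideals R \<subseteq> normalized_ideals S"
    using normalized_ideals_oversemigroup[OF R] by blast
  have fix_iff: "I + R = I \<longleftrightarrow> h I + h R = h I" if "I \<in> normalized_ideals S" for I
  proof -
    \<comment> \<open>Reflecting the equation uses injectivity of \<open>h\<close>, so
      \<open>I + R\<close> has to lie in its domain.\<close>
    have "I + R \<in> normalized_ideals S"
      using normalized_ideals_plus_closed[OF S that R'(1)] .
    then show ?thesis
      using that mult[OF that R'(1)] bij by (metis bij_betw_def inj_onD)
  qed
  have "h ` normalized_ideals R = normalized_ideals (h R)"
    unfolding normalized_ideals_oversemigroup[OF R] normalized_ideals_oversemigroup[OF hR]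
  proof (intro subset_antisym subsetI)
    fix J assume "J \<in> h ` {I \<in> normalized_ideals S. I + R = I}"
    then obtain I where "I \<in> normalized_ideals S" "I + R = I" "J = h I" by blast
    then show "J \<in> {J \<in> normalized_ideals T. J + h R = J}"
      using fix_iff bij by (metis (mono_tags, lifting) bij_betwE mem_Collect_eq)
  next
    fix J assume "J \<in> {J \<in> normalized_ideals T. J + h R = J}"
    then have J: "J \<in> normalized_ideals T" "J + h R = J" by auto
    then obtain I where "I \<in> normalized_ideals S" "J = h I"
      using bij by (metis bij_betw_def imageE)
    then show "J \<in> h ` {I \<in> normalized_ideals S. I + R = I}"
      using J(2) fix_iff by blast
  qed
  then have "bij_betw h (normalized_ideals R) (normalized_ideals (h R))"
    by (rule bij_betw_subset[OF bij sub])
  then show "h \<in> iso (normalized_ideal_monoid R) (normalized_ideal_monoid (h R))"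
    using mult sub by (auto simp: iso_normalized_ideal_monoid_iff)
qed

section \<open>Frobenius numbers and the symmetry of irreducible semigroups\<close>

lemma obtain_frobenius_number:
  assumes "numerical_semigroup S" "S \<noteq> UNIV"
  obtains F where "F \<notin> S" "\<And>x. F < x \<Longrightarrow> x \<in> S"
proof
  have "finite (UNIV - S)" "UNIV - S \<noteq> {}"
    using assms by (auto simp: numerical_semigroup_def)
  then show "Max (UNIV - S) \<notin> S" "\<And>x. Max (UNIV - S) < x \<Longrightarrow> x \<in> S"
    using Max_in[of "UNIV - S"] by (auto dest: Max_ge leD)
qed

lemma numerical_semigroup_insert:
  assumes S: "numerical_semigroup S"
    and "\<And>s. s \<in> S \<Longrightarrow> s \<noteq> 0 \<Longrightarrow> x + s \<in> S" "x + x \<in> S"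
  shows "numerical_semigroup (insert x S)"
proof -
  have "x + s \<in> insert x S" "s + x \<in> insert x S" if "s \<in> S" for s
    using assms(2)[OF that] by (cases "s = 0"; simp add: add.commute)+
  moreover have "finite (UNIV - insert x S)"
    using S by (auto simp: numerical_semigroup_def intro: rev_finite_subset)
  ultimately show ?thesis
    using S assms(3) by (auto simp: numerical_semigroup_def)
qed

text \<open>\<open>F + F\<close> and every \<open>F + s\<close> with \<open>s\<close> nonzero exceed
  \<open>F\<close>.\<close>

lemma numerical_semigroup_insert_frobenius:
  assumes "numerical_semigroup S" "F \<notin> S" "\<And>x. F < x \<Longrightarrow> x \<in> S"
  shows "numerical_semigroup (insert F S)"
proof -
  have "F \<noteq> 0" using assms(1,2) by (metis numerical_semigroup_def)
  then show ?thesis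
    using assms by (intro numerical_semigroup_insert) auto
qed

text \<open>A largest \<open>x\<close> violating the symmetry could be adjoined to \<open>S\<close>.\<close>

lemma irreducible_mem_iff:
  assumes S: "numerical_semigroup S"
    and F: "F \<notin> S" "\<And>x. F < x \<Longrightarrow> x \<in> S"
    and uniq: "\<And>x. x \<notin> S \<Longrightarrow> numerical_semigroup (insert x S) \<Longrightarrow> x = F"
    and x: "x \<le> F" "2 * x \<noteq> F"
  shows "x \<in> S \<longleftrightarrow> F - x \<notin> S"
proof
  show "F - x \<notin> S" if "x \<in> S"
  proof
    assume "F - x \<in> S"
    with that S have "x + (F - x) \<in> S" by (auto simp: numerical_semigroup_def)
    with x F show False by simp
  qed
next
  assume Fx: "F - x \<notin> S"
  show "x \<in> S"
  proof (rule ccontr)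
    assume "x \<notin> S"
    define A where "A = {y. y \<le> F \<and> y \<notin> S \<and> F - y \<notin> S \<and> 2 * y \<noteq> F}"
    have "x \<in> A" using x Fx \<open>x \<notin> S\<close> by (simp add: A_def)
    have fin: "finite A" by (rule finite_subset[of _ "{..F}"]) (auto simp: A_def)
    define m where "m = Max A"
    have "m \<in> A" using Max_in[OF fin] \<open>x \<in> A\<close> by (auto simp: m_def)
    then have m: "m \<le> F" "m \<notin> S" "F - m \<notin> S" "2 * m \<noteq> F" by (auto simp: A_def)
    \<comment> \<open>The conditions in \<open>A\<close> are invariant under reflection at
      \<open>F/2\<close>, so the maximum \<open>m\<close> lies strictly above the midpoint.\<close>
    then have "F - m \<in> A" by (auto simp: A_def)
    then have "F - m \<le> m" using fin by (simp add: m_def)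
    then have "F < m + m" using m by linarith
    have "m + s \<in> S" if s: "s \<in> S" "s \<noteq> 0" for s
    proof (rule ccontr)
      assume ms: "m + s \<notin> S"
      have "m + s \<notin> A"
        using Max_ge[OF fin, of "m + s"] s(2) by (auto simp: m_def)
      moreover have le: "m + s \<le> F" using ms F(2) by (meson not_le_imp_less)
      \<comment> \<open>By \<open>F < m + m\<close> the gap \<open>m + s\<close> is not the
        midpoint, so only the condition on \<open>F - (m + s)\<close> can exclude it from
        \<open>A\<close>. Adding \<open>s\<close> then contradicts
        \<open>F - m \<notin> S\<close>.\<close>
      ultimately have "F - (m + s) \<in> S"
        using ms \<open>F < m + m\<close> by (auto simp: A_def)
      then have "F - (m + s) + s \<in> S"
        using s S by (auto simp: numerical_semigroup_def)
      with le m show False by simp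
    qed
    moreover have "m + m \<in> S" using F(2) \<open>F < m + m\<close> by blast
    ultimately have "m = F"
      using uniq m(2) numerical_semigroup_insert[OF S] by blast
    \<comment> \<open>For \<open>m = F\<close> the gap \<open>F - m\<close> would be
      \<open>0\<close>.\<close>
    with m S show False by (auto simp: numerical_semigroup_def)
  qed
qed

section \<open>Counting elements up to the Frobenius number\<close>

text \<open>The reflection \<open>x \<mapsto> F - x\<close> exchanges the elements of
  \<open>S\<close> up to \<open>F\<close> with the non-elements other than the midpoint
  \<open>F/2\<close>, which exists exactly for even \<open>F\<close>.\<close>

lemma card_half_of_symmetric:
  fixes F :: nat
  assumes "\<And>x. x \<le> F \<Longrightarrow> 2 * x \<noteq> F \<Longrightarrow> x \<in> S \<longleftrightarrow> F - x \<notin> S"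
    and "\<And>x. 2 * x = F \<Longrightarrow> x \<notin> S"
  shows "card (S \<inter> {..F}) = (F + 1) div 2"
proof -
  let ?A = "S \<inter> {..F}" and ?B = "(\<lambda>x. F - x) ` (S \<inter> {..F})"
  have dbl: "2 * (F - x) = F \<longleftrightarrow> 2 * x = F" if "x \<le> F" for x using that by auto
  have B: "x \<in> ?B \<longleftrightarrow> x \<le> F \<and> F - x \<in> S" for x
    by (auto simp: image_iff intro!: bexI[of _ "F - x"])
  have disj: "?A \<inter> ?B = {}"
    using assms B by auto
  have un: "?A \<union> ?B = {..F} - {x. 2 * x = F}"
  proof (rule Set.set_eqI)
    fix x
    show "x \<in> ?A \<union> ?B \<longleftrightarrow> x \<in> {..F} - {x. 2 * x = F}"
      using assms(1)[of x] assms(2)[of x] assms(2)[of "F - x"] dbl[of x] B[of x] by blast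
  qed
  have "card ?B = card ?A"
    by (intro card_image inj_onI) auto
  then have two: "2 * card ?A = card ({..F} - {x. 2 * x = F})"
    using card_Un_disjoint[of ?A ?B] disj un by simp
  show ?thesis
  proof (cases "even F")
    case True
    then obtain k where "F = 2 * k" by blast
    then have "{x. 2 * x = F} = {k}" "k \<in> {..F}" by auto
    then show ?thesis using two \<open>F = 2 * k\<close> by simp
  next
    case False
    then have "{x. 2 * x = F} = {}" by auto
    then show ?thesis using two by simp
  qed
qed

lemma irreducible_card:
  assumes S: "numerical_semigroup S"
    and F: "F \<notin> S" "\<And>x. F < x \<Longrightarrow> x \<in> S"
    and uniq: "\<And>x. x \<notin> S \<Longrightarrow> numerical_semigroup (insert x S) \<Longrightarrow> x = F"
  shows "card (S \<inter> {..F}) = (F + 1) div 2"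
proof (rule card_half_of_symmetric)
  show "x \<in> S \<longleftrightarrow> F - x \<notin> S" if "x \<le> F" "2 * x \<noteq> F" for x
    using irreducible_mem_iff[OF S F uniq that] .
  show "x \<notin> S" if "2 * x = F" for x
    using S F(1) that by (auto simp: numerical_semigroup_def mult_2)
qed

lemma irreducible_frobenius_consecutive:
  assumes S: "numerical_semigroup S"
    and F: "F \<notin> S" "\<And>x. F < x \<Longrightarrow> x \<in> S"
    and uniqS: "\<And>x. x \<notin> S \<Longrightarrow> numerical_semigroup (insert x S) \<Longrightarrow> x = F"
    and T: "numerical_semigroup T"
    and G: "G \<notin> T" "\<And>x. G < x \<Longrightarrow> x \<in> T"
    and uniqT: "\<And>x. x \<notin> T \<Longrightarrow> numerical_semigroup (insert x T) \<Longrightarrow> x = G"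
    and eq: "insert F S = insert G T" and less: "G < F"
  shows "odd F" "even G"
proof -
  have mem: "x = F \<or> x \<in> S \<longleftrightarrow> x = G \<or> x \<in> T" for x
    using eq by (metis insert_iff)
  \<comment> \<open>The semigroups differ only in that \<open>G\<close> belongs to \<open>S\<close>
    and \<open>F\<close> to \<open>T\<close>; all numbers strictly between \<open>G\<close> and
    \<open>F\<close> lie in both.\<close>
  have "x \<in> S \<inter> {..F} \<longleftrightarrow> x \<in> (T \<inter> {..G}) \<union> {G..<F}" for x
    using mem[of x] less F(1) G(1) G(2)[of x] by (cases "x = F"; cases "x = G"; force)
  then have "S \<inter> {..F} = (T \<inter> {..G}) \<union> {G..<F}" by blast
  then have "card (S \<inter> {..F}) = card (T \<inter> {..G}) + (F - G)"
    using card_Un_disjoint[of "T \<inter> {..G}" "{G..<F}"] G(1) by (force simp: order.order_iff_strict)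
  then have "(F + 1) div 2 = (G + 1) div 2 + (F - G)"
    using irreducible_card[OF S F uniqS] irreducible_card[OF T G uniqT] by simp
  \<comment> \<open>With \<open>d = F - G\<close>, the two rounded halves differ by at most
    \<open>(d + 1)/2\<close>, so \<open>d = 1\<close>; the increase by one then makes
    \<open>G + 1\<close> odd.\<close>
  then have "F = G + 1" "(G + 2) div 2 = (G + 1) div 2 + 1" using less by auto
  then show "odd F" "even G" by presburger+
qed

section \<open>Ideals that absorb the Frobenius number\<close>

text \<open>A gap \<open>x\<close> of \<open>S\<close> in \<open>I\<close> is not the midpoint
  because \<open>F\<close> is odd, so symmetry gives \<open>F - x \<in> S\<close> and
  \<open>F = x + (F - x)\<close> lies in \<open>I\<close>. For \<open>i > 0\<close> the sum
  \<open>i + F\<close> exceeds \<open>F\<close> and lies in \<open>S \<subseteq> I\<close>.\<close>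

lemma symmetric_ideal_plus_oversemigroup:
  assumes S: "numerical_semigroup S"
    and F: "F \<notin> S" "\<And>x. F < x \<Longrightarrow> x \<in> S"
    and uniq: "\<And>x. x \<notin> S \<Longrightarrow> numerical_semigroup (insert x S) \<Longrightarrow> x = F"
    and odd: "odd F"
    and I: "I \<in> normalized_ideals S" "I \<noteq> S"
  shows "I + insert F S = I"
proof
  have SI: "i + s \<in> I" if "i \<in> I" "s \<in> S" for i s
    using I(1) that by (auto simp: mem_normalized_ideals_iff)
  have "0 \<in> I" using I(1) by (simp add: mem_normalized_ideals_iff)
  then have sub: "S \<subseteq> I" using SI[of 0] by auto
  then obtain x where x: "x \<in> I" "x \<notin> S" using I(2) by blast
  then have "x \<le> F" using F(2) by (meson not_le_imp_less)
  moreover have "2 * x \<noteq> F" using odd by auto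
  ultimately have "F - x \<in> S" using irreducible_mem_iff[OF S F uniq] x by blast
  then have "F \<in> I" using SI[OF x(1)] \<open>x \<le> F\<close> by fastforce
  have "i + F \<in> I" if "i \<in> I" for i
    using \<open>F \<in> I\<close> F(2)[of "i + F"] sub by (cases "i = 0") auto
  then show "I + insert F S \<subseteq> I" using SI by (auto simp: set_plus_def)
  show "I \<subseteq> I + insert F S"
    using S set_zero_plus2[of "insert F S" I] by (simp add: numerical_semigroup_def add.commute)
qed

text \<open>If \<open>k + s\<close> were a gap other than \<open>k\<close>, symmetry would put
  \<open>F - (k + s)\<close> into \<open>S\<close>, and adding \<open>s\<close> would give
  \<open>k \<in> S\<close>. The result is an ideal but no semigroup, as
  \<open>k + k = F\<close>.\<close>

lemma pseudo_symmetric_insert_half: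
  assumes S: "numerical_semigroup S"
    and F: "F \<notin> S" "\<And>x. F < x \<Longrightarrow> x \<in> S"
    and uniq: "\<And>x. x \<notin> S \<Longrightarrow> numerical_semigroup (insert x S) \<Longrightarrow> x = F"
    and k: "F = 2 * k"
  shows "insert k S \<in> normalized_ideals S"
proof -
  have "k \<notin> S" using S F(1) k by (auto simp: numerical_semigroup_def mult_2)
  have "k + s \<in> insert k S" if s: "s \<in> S" for s
  proof (rule ccontr)
    assume ks: "k + s \<notin> insert k S"
    then have le: "k + s \<le> F" using F(2) by (meson insertCI not_le_imp_less)
    moreover have "2 * (k + s) \<noteq> F" using ks k by auto
    ultimately have "F - (k + s) \<in> S" using irreducible_mem_iff[OF S F uniq] ks by blast
    then have "F - (k + s) + s \<in> S" using S s by (auto simp: numerical_semigroup_def)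
    then show False using le k \<open>k \<notin> S\<close> by simp
  qed
  moreover have "a + s \<in> insert k S" if "a \<in> S" "s \<in> S" for a s
    using S that by (simp add: numerical_semigroup_def)
  ultimately have "insert k S + S \<subseteq> insert k S"
    by (metis insertE set_plus_elim subsetI)
  then show ?thesis
    using S by (simp add: mem_normalized_ideals_iff numerical_semigroup_def)
qed

text \<open>For \<open>G < F\<close>, \<open>h\<close> would transport absorption of the common
  oversemigroup to all ideals of \<open>T\<close> other than \<open>T\<close>, but
  \<open>insert k T\<close> with \<open>G = 2 * k\<close> lacks it. The pairs \<open>S\<close>,
  \<open>F\<close> and \<open>T\<close>, \<open>G\<close> are kept separate so that a swap also
  excludes \<open>F < G\<close>.\<close>

lemma iso_imp_not_frobenius_less:
  assumes S: "numerical_semigroup S"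
    and F: "F \<notin> S" "\<And>x. F < x \<Longrightarrow> x \<in> S"
    and uniqS: "\<And>x. x \<notin> S \<Longrightarrow> numerical_semigroup (insert x S) \<Longrightarrow> x = F"
    and T: "numerical_semigroup T"
    and G: "G \<notin> T" "\<And>x. G < x \<Longrightarrow> x \<in> T"
    and uniqT: "\<And>x. x \<notin> T \<Longrightarrow> numerical_semigroup (insert x T) \<Longrightarrow> x = G"
    and eq: "insert F S = insert G T"
    and h: "h \<in> iso (normalized_ideal_monoid S) (normalized_ideal_monoid T)"
    and fixed: "h (insert F S) = insert F S"
  shows "\<not> G < F"
proof
  assume "G < F"
  then have "odd F" "even G"
    using irreducible_frobenius_consecutive[OF S F uniqS T G uniqT eq] by auto
  then obtain k where k: "G = 2 * k" by blast
  let ?J = "insert k T"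
  have bij: "bij_betw h (normalized_ideals S) (normalized_ideals T)"
    using h by (simp add: iso_normalized_ideal_monoid_iff)
  have J: "?J \<in> normalized_ideals T"
    using pseudo_symmetric_insert_half[OF T G uniqT k] .
  then obtain I where I: "I \<in> normalized_ideals S" "h I = ?J"
    using bij by (metis bij_betw_def imageE)
  \<comment> \<open>\<open>G \<notin> ?J\<close> needs \<open>G \<noteq> k\<close>.\<close>
  have "k \<noteq> 0" using G(1) T k by (metis numerical_semigroup_def mult_0_right)
  then have "k \<notin> T" "G \<notin> ?J"
    using T G(1) k by (auto simp: numerical_semigroup_def mult_2)
  \<comment> \<open>This excludes \<open>I = S\<close>, the one ideal that does not absorb
    \<open>insert F S\<close>.\<close>
  have "h S = T"
    using iso_preserves_one[OF _ _ h] monoid_normalized_ideal_monoid S T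
    by (simp add: normalized_ideal_monoid_def)
  then have "I \<noteq> S" using I \<open>k \<notin> T\<close> by auto
  then have IF: "I + insert F S = I"
    using symmetric_ideal_plus_oversemigroup[OF S F uniqS \<open>odd F\<close> I(1)] by blast
  have "insert F S \<in> normalized_ideals S"
    using numerical_semigroup_insert_frobenius[OF S F] idempotent_normalized_ideal_iff[OF S] by blast
  then have "?J + insert G T = ?J"
    using h I IF fixed eq by (metis iso_normalized_ideal_monoid_iff)
  moreover have "0 + G \<in> ?J + insert G T"
    using T by (intro set_plus_intro) (auto simp: numerical_semigroup_def)
  ultimately show False using \<open>G \<notin> ?J\<close> by simp
qed

section \<open>Comparing proper oversemigroups\<close>

text \<open>\<open>insert F S\<close> contains \<open>T\<close> while \<open>S\<close> does not, so
  \<open>F \<in> T\<close>; likewise \<open>G \<in> S\<close>.\<close>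

lemma same_proper_oversemigroups_cases:
  assumes S: "numerical_semigroup S" and T: "numerical_semigroup T"
    and over: "\<And>R. numerical_semigroup R \<and> S \<subset> R \<longleftrightarrow> numerical_semigroup R \<and> T \<subset> R"
    and "S \<noteq> T"
  obtains F G where "F \<notin> S" "\<And>x. F < x \<Longrightarrow> x \<in> S" "G \<notin> T" "\<And>x. G < x \<Longrightarrow> x \<in> T"
    and "insert F S = insert G T"
    and "\<And>x. x \<notin> S \<Longrightarrow> numerical_semigroup (insert x S) \<Longrightarrow> x = F"
    and "\<And>x. x \<notin> T \<Longrightarrow> numerical_semigroup (insert x T) \<Longrightarrow> x = G"
proof -
  have nsub: "\<not> S \<subset> T" "\<not> T \<subset> S" using over S T by blast+
  then have "S \<noteq> UNIV" "T \<noteq> UNIV" using \<open>S \<noteq> T\<close> by auto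
  obtain F where F: "F \<notin> S" "\<And>x. F < x \<Longrightarrow> x \<in> S"
    using obtain_frobenius_number[OF S \<open>S \<noteq> UNIV\<close>] by blast
  obtain G where G: "G \<notin> T" "\<And>x. G < x \<Longrightarrow> x \<in> T"
    using obtain_frobenius_number[OF T \<open>T \<noteq> UNIV\<close>] by blast
  have "T \<subset> insert F S"
    using over[of "insert F S"] numerical_semigroup_insert_frobenius[OF S F] F(1) by blast
  moreover have "S \<subset> insert G T"
    using over[of "insert G T"] numerical_semigroup_insert_frobenius[OF T G] G(1) by blast
  ultimately have FG: "F \<in> T" "G \<in> S" "insert F S = insert G T"
    using nsub \<open>S \<noteq> T\<close> by blast+
  \<comment> \<open>\<open>insert x S\<close> contains \<open>T\<close> and hence \<open>F\<close>;
    as \<open>F \<notin> S\<close>, this leaves \<open>x = F\<close>.\<close>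
  have "x = F" if "x \<notin> S" "numerical_semigroup (insert x S)" for x
    using over[of "insert x S"] that FG F by blast
  moreover have "x = G" if "x \<notin> T" "numerical_semigroup (insert x T)" for x
    using over[of "insert x T"] that FG G by blast
  ultimately show ?thesis using that F G FG(3) by blast
qed

section \<open>Induction on the number of gaps\<close>

theorem theorem18:
  fixes S T :: "nat set"
  assumes "numerical_semigroup S"
    and "numerical_semigroup T"
    and "normalized_ideal_monoid S \<cong> normalized_ideal_monoid T"
  shows "S = T"
  using assms
proof (induction "card (UNIV - S)" arbitrary: S T rule: less_induct)
  case less
  note S = less.prems(1) and T = less.prems(2)
  obtain h where h: "h \<in> iso (normalized_ideal_monoid S) (normalized_ideal_monoid T)"
    using less.prems(3) by (auto simp: is_iso_def)
  have monS: "monoid (normalized_ideal_monoid S)" and monT: "monoid (normalized_ideal_monoid T)"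
    using S T by (simp_all add: monoid_normalized_ideal_monoid)
  define g where "g = inv_into (normalized_ideals S) h"
  have g: "g \<in> iso (normalized_ideal_monoid T) (normalized_ideal_monoid S)"
    using iso_normalized_ideal_monoid_inv_into[OF S h] by (simp add: g_def)
  have bij: "bij_betw h (normalized_ideals S) (normalized_ideals T)"
    using h by (simp add: iso_normalized_ideal_monoid_iff)
  have hS: "h S = T"
    using iso_preserves_one[OF monS monT h] by (simp add: normalized_ideal_monoid_def)
  have fixed: "h R = R" if R: "numerical_semigroup R" "S \<subset> R" for R
  proof -
    \<comment> \<open>\<open>R\<close> has fewer gaps than \<open>S\<close>, so the induction
      hypothesis applies to the pair \<open>R\<close>, \<open>h R\<close>; for this the second
      semigroup is kept arbitrary.\<close>
    have "card (UNIV - R) < card (UNIV - S)"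
      using S R by (intro psubset_card_mono) (auto simp: numerical_semigroup_def)
    then show ?thesis
      using less.hyps[of R "h R"] R iso_normalized_ideal_monoid_oversemigroup[OF S T h R(1)]
      by (auto simp: is_iso_def)
  qed
  have mem: "R \<in> normalized_ideals S" if "numerical_semigroup R" "S \<subset> R" for R
    using that idempotent_normalized_ideal_iff[OF S] by blast
  have gfixed: "g R = R" if "numerical_semigroup R" "S \<subset> R" for R
    using fixed[OF that] mem[OF that] bij unfolding g_def
    by (metis bij_betw_inv_into_left)
  have over: "numerical_semigroup R \<and> S \<subset> R \<longleftrightarrow> numerical_semigroup R \<and> T \<subset> R" for R
  proof
    assume R: "numerical_semigroup R \<and> S \<subset> R"
    then have "T \<subseteq> R"
      using iso_normalized_ideal_monoid_oversemigroup(2)[OF S T h, of R] fixed by auto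
    \<comment> \<open>Otherwise \<open>h R = R = T = h S\<close>, and injectivity would give
      \<open>R = S\<close>.\<close>
    moreover have "R \<noteq> T"
      using R fixed mem hS bij normalized_ideals_self[OF S]
      by (metis bij_betw_def inj_onD psubsetE)
    ultimately show "numerical_semigroup R \<and> T \<subset> R" using R by blast
  next
    assume R: "numerical_semigroup R \<and> T \<subset> R"
    then have gR: "numerical_semigroup (g R)" "S \<subseteq> g R"
      using iso_normalized_ideal_monoid_oversemigroup[OF T S g] by auto
    have "h (g R) = R"
      using R idempotent_normalized_ideal_iff[OF T] bij unfolding g_def
      by (metis bij_betw_inv_into_right psubset_imp_subset)
    \<comment> \<open>Thus \<open>g R\<close> properly contains \<open>S\<close>, is fixed by
      \<open>h\<close>, and so equals \<open>R\<close>.\<close>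
    then have "S \<noteq> g R" using hS R by auto
    then show "numerical_semigroup R \<and> S \<subset> R"
      using gR fixed[of "g R"] \<open>h (g R) = R\<close> by (metis psubsetI)
  qed
  show ?case
  proof (rule ccontr)
    assume "S \<noteq> T"
    then obtain F G where F: "F \<notin> S" "\<And>x. F < x \<Longrightarrow> x \<in> S"
      and G: "G \<notin> T" "\<And>x. G < x \<Longrightarrow> x \<in> T"
      and eq: "insert F S = insert G T"
      and uniqS: "\<And>x. x \<notin> S \<Longrightarrow> numerical_semigroup (insert x S) \<Longrightarrow> x = F"
      and uniqT: "\<And>x. x \<notin> T \<Longrightarrow> numerical_semigroup (insert x T) \<Longrightarrow> x = G"
      using same_proper_oversemigroups_cases[OF S T over] by metis
    have insF: "numerical_semigroup (insert F S)" "S \<subset> insert F S"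
      using numerical_semigroup_insert_frobenius[OF S F] F(1) by auto
    have "\<not> G < F"
      using iso_imp_not_frobenius_less[OF S F uniqS T G uniqT eq h fixed[OF insF]] .
    \<comment> \<open>The roles are exchanged: \<open>g\<close> also fixes the common
      oversemigroup.\<close>
    moreover have "\<not> F < G"
      using iso_imp_not_frobenius_less[OF T G uniqT S F uniqS eq[symmetric] g]
        gfixed[OF insF] eq by simp
    ultimately have "F = G" by simp
    \<comment> \<open>The number \<open>F = G\<close> lies in neither semigroup and cancels from
      \<open>eq\<close>.\<close>
    then show False using eq F G \<open>S \<noteq> T\<close> by (metis insert_ident)
  qed
qed

end
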